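(* Let $G=(V,E)$ be a finite simple undirected graph and let $\ell>0$ be an integer. For $v\in V$, let $\mathcal{T}_{v,\ell}$ be the set of subtrees of $G$ with exactly $\ell$ vertices that contain $v$. For a subgraph $H$ of $G$, let $r(H)=|\mathcal{R}(H)|$ be the number of relaxed legal configurations on $H$, and for $T\in\mathcal{T}_{v,\ell}$ let $G-T$ denote the graph obtained from $G$ by deleting the vertices of $T$. Then the number of pairs $(C,v)\in\mathcal{R}(G)\times V$ such that seeding $C$ at $v$ results in a burn-off game of length $\ell$ equals $$\sum_{v\in V}\ \sum_{T\in\mathcal{T}_{v,\ell}} r(G-T).$$
   Context: A (chip) configuration on a graph $H$ is a function $C\colon V(H)\to\mathbb{N}$. A vertex $v$ can fire if $C(v)>\deg_H(v)$; firing $v$ decreases $C(v)$ by $\deg_H(v)+1$ and increases $C(u)$ by $1$ for every neighbor $u$ of $v$. A configuration is relaxed if no vertex can fire. A configuration is supercritical if $C(v)>\deg_H(v)$ for every vertex $v$. Reverse-firing $v$ in $C'$ is allowed only when every neighbor $u$ of $v$ has $C'(u)\ge 1$; it increases $C'(v)$ by $\deg_H(v)+1$ and decreases each neighbor's count by $1$. A configuration is legal if some sequence of reverse-firings takes it to a supercritical configuration. $\mathcal{R}(H)$ is the set of relaxed legal configurations on $H$ (when $H$ has no vertices, $\mathcal{R}(H)$ consists of the single empty configuration, so $r(H)=1$). Seeding a relaxed configuration $C$ on $G$ at $v$ means passing to $C+\mathbf{1}_v$ (adding one chip to $v$) and then repeatedly firing vertices that can fire until a relaxed configuration is reached; the length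 of this burn-off game is the total number of vertex firings (this number, and the final configuration, do not depend on the order of firings). *)

theory Defs
  imports "HOL-Library.FuncSet"
begin

section \<open>Undirected graphs\<close>

text \<open>
  A graph is a vertex set together with a set of two-element vertex sets. (In the AFP entry
  Graph_Theory undirected graphs are symmetric digraphs, in which an edge traversed back and
  forth is a cycle; its notion of tree is therefore not that of undirected graphs.)
\<close>

record 'a ugraph =
  uverts :: "'a set"
  uedges :: "'a set set"

definition fin_simple_graph :: "'a ugraph \<Rightarrow> bool" where
  "fin_simple_graph G \<longleftrightarrow>
     finite (uverts G) \<and> (\<forall>e\<in>uedges G. e \<subseteq> uverts G \<and> card e = 2)"

definition nbrs :: "'a ugraph \<Rightarrow> 'a \<Rightarrow> 'a set" where
  "nbrs G v = {u. {v, u} \<in> uedges G}"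

definition deg :: "'a ugraph \<Rightarrow> 'a \<Rightarrow> nat" where
  "deg G v = card (nbrs G v)"

definition usubgraph :: "'a ugraph \<Rightarrow> 'a ugraph \<Rightarrow> bool" where
  "usubgraph H G \<longleftrightarrow>
     uverts H \<subseteq> uverts G \<and> uedges H \<subseteq> uedges G \<and> (\<forall>e\<in>uedges H. e \<subseteq> uverts H)"

definition del_uverts :: "'a ugraph \<Rightarrow> 'a set \<Rightarrow> 'a ugraph" where
  "del_uverts G W =
     \<lparr>uverts = uverts G - W, uedges = {e \<in> uedges G. e \<inter> W = {}}\<rparr>"

definition uconnected :: "'a ugraph \<Rightarrow> bool" where
  "uconnected G \<longleftrightarrow> uverts G \<noteq> {} \<and>
     (\<forall>u\<in>uverts G. \<forall>v\<in>uverts G. (u, v) \<in> {(x, y). {x, y} \<in> uedges G}\<^sup>*)"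

text \<open>A cycle is the list of its at least three distinct vertices in cyclic order.\<close>

definition ucycle :: "'a ugraph \<Rightarrow> 'a list \<Rightarrow> bool" where
  "ucycle G p \<longleftrightarrow> length p \<ge> 3 \<and> distinct p \<and>
     (\<forall>i < length p. {p ! i, p ! (Suc i mod length p)} \<in> uedges G)"

definition utree :: "'a ugraph \<Rightarrow> bool" where
  "utree T \<longleftrightarrow> uconnected T \<and> (\<nexists>p. ucycle T p)"

text \<open>Subtrees are subgraphs, not necessarily induced ones: different edge sets on the same
  vertices give different subtrees.\<close>

definition subtrees :: "'a ugraph \<Rightarrow> 'a \<Rightarrow> nat \<Rightarrow> 'a ugraph set" where
  "subtrees G v l = {T. usubgraph T G \<and> utree T \<and> card (uverts T) = l \<and> v \<in> uverts T}"


section \<open>Chip configurations and the burn-off game\<close>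

text \<open>
  Functions on the vertex set are extensional (\<open>undefined\<close> elsewhere), so that configurations can
  be counted; on the graph without vertices there is exactly one.
\<close>

definition configs :: "'a ugraph \<Rightarrow> ('a \<Rightarrow> nat) set" where
  "configs G = uverts G \<rightarrow>\<^sub>E UNIV"

definition can_fire :: "'a ugraph \<Rightarrow> ('a \<Rightarrow> nat) \<Rightarrow> 'a \<Rightarrow> bool" where
  "can_fire G C v \<longleftrightarrow> v \<in> uverts G \<and> C v > deg G v"

definition fire :: "'a ugraph \<Rightarrow> 'a \<Rightarrow> ('a \<Rightarrow> nat) \<Rightarrow> ('a \<Rightarrow> nat)" where
  "fire G v C =
     (\<lambda>u. if u = v then C u - (deg G v + 1) else if u \<in> nbrs G v then C u + 1 else C u)"

definition fire_step :: "'a ugraph \<Rightarrow> ('a \<Rightarrow> nat) \<Rightarrow> ('a \<Rightarrow> nat) \<Rightarrow> bool" where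
  "fire_step G C C' \<longleftrightarrow> (\<exists>v. can_fire G C v \<and> C' = fire G v C)"

definition relaxed :: "'a ugraph \<Rightarrow> ('a \<Rightarrow> nat) \<Rightarrow> bool" where
  "relaxed G C \<longleftrightarrow> (\<nexists>v. can_fire G C v)"

definition supercritical :: "'a ugraph \<Rightarrow> ('a \<Rightarrow> nat) \<Rightarrow> bool" where
  "supercritical G C \<longleftrightarrow> (\<forall>v\<in>uverts G. C v > deg G v)"

definition can_rev_fire :: "'a ugraph \<Rightarrow> ('a \<Rightarrow> nat) \<Rightarrow> 'a \<Rightarrow> bool" where
  "can_rev_fire G C v \<longleftrightarrow> v \<in> uverts G \<and> (\<forall>u\<in>nbrs G v. C u \<ge> 1)"

definition rev_fire :: "'a ugraph \<Rightarrow> 'a \<Rightarrow> ('a \<Rightarrow> nat) \<Rightarrow> ('a \<Rightarrow> nat)" where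
  "rev_fire G v C =
     (\<lambda>u. if u = v then C u + (deg G v + 1) else if u \<in> nbrs G v then C u - 1 else C u)"

definition rev_fire_step :: "'a ugraph \<Rightarrow> ('a \<Rightarrow> nat) \<Rightarrow> ('a \<Rightarrow> nat) \<Rightarrow> bool" where
  "rev_fire_step G C C' \<longleftrightarrow> (\<exists>v. can_rev_fire G C v \<and> C' = rev_fire G v C)"

definition legal :: "'a ugraph \<Rightarrow> ('a \<Rightarrow> nat) \<Rightarrow> bool" where
  "legal G C \<longleftrightarrow> (\<exists>D. (rev_fire_step G)\<^sup>*\<^sup>* C D \<and> supercritical G D)"

definition relaxed_legal :: "'a ugraph \<Rightarrow> ('a \<Rightarrow> nat) set" where
  "relaxed_legal G = {C \<in> configs G. relaxed G C \<and> legal G C}"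

definition num_relaxed_legal :: "'a ugraph \<Rightarrow> nat" where
  "num_relaxed_legal G = card (relaxed_legal G)"

text \<open>
  Seeding \<open>C\<close> at \<open>v\<close> results in a game of length \<open>l\<close>: some sequence of exactly \<open>l\<close> firings leads
  from \<open>C\<close> with one chip added at \<open>v\<close> to a relaxed configuration. Since the length does not
  depend on the order of firings, it is immaterial that one sequence is asked for.
\<close>

definition burn_off_game_length :: "'a ugraph \<Rightarrow> ('a \<Rightarrow> nat) \<Rightarrow> 'a \<Rightarrow> nat \<Rightarrow> bool" where
  "burn_off_game_length G C v l \<longleftrightarrow>
     (\<exists>D. (fire_step G ^^ l) (C(v := C v + 1)) D \<and> relaxed G D)"

end

(*
  A vertex fires at most once after seeding, so a burn-off game is determined by the set S of
  vertices that fire. Legality is Dhar's criterion (no forbidden subconfiguration), and for a given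
  S it decouples: outside S the configuration is an arbitrary relaxed legal one on G - S, inside S it
  is essentially a parking function of G[S] rooted at v. Parking functions and spanning trees of G[S]
  are both choices, made at each vertex, that let a fire started at v reach all of S; the number of
  choices that make a vertex u burn once B is burnt is the number of neighbours of u in B in
  both cases. Peeling off the vertices that burn first shows that these numbers determine the count.
*)
theory Submission
  imports Defs "HOL-Library.Transitive_Closure_Table"
begin

section \<open>Burning systems\<close>

text \<open>A vertex of a relaxed configuration has at most deg chips, hence at most deg + 1 after
  seeding, and it receives at most deg more while its neighbours have fired at most once each.
  Having fired, it is left with at most deg chips, so no vertex can be the first to fire twice. The
  decoupling has two sources. That S does not set off an outside vertex u means C u + |N(u) \<inter>
  S| \<le> deg u, which is relaxedness in G - S. In Dhar's test, a set that meets S passes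
  automatically because S burns, so only the sets inside G - S remain to be tested. Neither side has
  a canonical order of burning. The proof therefore never describes a fire by a sequence, but by a
  condition on all nonempty sets W of vertices that might be left over: some member of W burns from
  what lies outside W. A bijection between parking functions and trees would need an ordering of the
  neighbours of every vertex. Comparing only the numbers of choices avoids these orderings.\<close>

text \<open>\<open>q u\<close> is the choice made at \<open>u\<close>, \<open>ok u c B\<close> says
  that choice \<open>c\<close> lets \<open>u\<close> burn once \<open>B\<close> has burnt, and
  \<open>A\<close> is burnt from the start. A fire that stopped early would leave a set
  \<open>W\<close> violating the condition.\<close>

definition burning ::
    "('a \<Rightarrow> 'b set) \<Rightarrow> ('a \<Rightarrow> 'b \<Rightarrow> 'a set \<Rightarrow> bool) \<Rightarrow> 'a set \<Rightarrow> 'a set \<Rightarrow> ('a \<Rightarrow> 'b) set" where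
  "burning Q ok A U =
     {q \<in> PiE U Q. \<forall>W\<subseteq>U. W \<noteq> {} \<longrightarrow> (\<exists>u\<in>W. ok u (q u) (A \<union> (U - W)))}"

lemma card_PiE_split:
  assumes "L \<inter> M = {}" "X \<subseteq> L \<rightarrow>\<^sub>E UNIV" "Y \<subseteq> M \<rightarrow>\<^sub>E UNIV"
  shows "card {q \<in> (L \<union> M) \<rightarrow>\<^sub>E UNIV. restrict q L \<in> X \<and> restrict q M \<in> Y} = card X * card Y"
    (is "card ?Z = _")
proof -
  define h where "h = (\<lambda>(x :: 'a \<Rightarrow> 'b, y :: 'a \<Rightarrow> 'b) u. if u \<in> L then x u else y u)"
  have rL: "restrict (h (x, y)) L = x" if "x \<in> X" for x y
    using that assms(2) unfolding h_def by (fastforce simp: PiE_def extensional_def restrict_def)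
  have rM: "restrict (h (x, y)) M = y" if "y \<in> Y" for x y
  proof
    fix u
    show "restrict (h (x, y)) M u = y u"
      using that assms(1,3) unfolding h_def by (auto simp: PiE_def extensional_def restrict_def)
  qed
  have "bij_betw (\<lambda>q. (restrict q L, restrict q M)) ?Z (X \<times> Y)"
  proof (rule bij_betw_byWitness[where f' = h])
    show "\<forall>q\<in>?Z. h (restrict q L, restrict q M) = q"
      unfolding h_def by (fastforce simp: PiE_def extensional_def restrict_def)
    show "\<forall>p\<in>X \<times> Y. (restrict (h p) L, restrict (h p) M) = p"
      using rL rM by auto
    show "(\<lambda>q. (restrict q L, restrict q M)) ` ?Z \<subseteq> X \<times> Y"
      by auto
    show "h ` (X \<times> Y) \<subseteq> ?Z"
    proof clarify
      fix x y assume xy: "x \<in> X" "y \<in> Y"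
      have "h (x, y) \<in> (L \<union> M) \<rightarrow>\<^sub>E UNIV"
        using subsetD[OF assms(3) xy(2)] unfolding h_def
        by (auto simp: PiE_def extensional_def)
      then show "h (x, y) \<in> (L \<union> M) \<rightarrow>\<^sub>E UNIV
          \<and> restrict (h (x, y)) L \<in> X \<and> restrict (h (x, y)) M \<in> Y"
        using rL rM xy by simp
    qed
  qed
  then show ?thesis
    by (simp add: bij_betw_same_card card_cartesian_product)
qed

text \<open>\<open>L\<close> is the first layer, the vertices ignited by \<open>A\<close> directly;
  testing \<open>W = U\<close> shows that it is nonempty unless \<open>U\<close> is. The other
  vertices made choices that fail at \<open>A\<close>, and they form a burning system again, with
  \<open>A \<union> L\<close> burnt. Conversely, a set \<open>W\<close> that meets \<open>L\<close>
  passes by monotonicity, and one that avoids \<open>L\<close> passes by the residual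
  system.\<close>

lemma burning_layer:
  assumes mono: "\<And>u c. mono (ok u c)"
    and L: "L \<subseteq> U"
  shows "{q \<in> burning Q ok A U. {u \<in> U. ok u (q u) A} = L} =
    (if U \<noteq> {} \<and> L = {} then {} else
     {q \<in> (L \<union> (U - L)) \<rightarrow>\<^sub>E UNIV. restrict q L \<in> PiE L (\<lambda>u. {c \<in> Q u. ok u c A}) \<and>
        restrict q (U - L) \<in> burning (\<lambda>u. {c \<in> Q u. \<not> ok u c A}) ok (A \<union> L) (U - L)})"
    (is "?X = ?R")
proof (cases "U \<noteq> {} \<and> L = {}")
  case True
  have "?X = {}"
  proof (rule equals0I)
    fix q assume "q \<in> ?X"
    then have "\<exists>u\<in>U. ok u (q u) (A \<union> (U - U))" "{u \<in> U. ok u (q u) A} = L"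
      using True unfolding burning_def by blast+
    then show False using True by auto
  qed
  then show ?thesis using True by simp
next
  case False
  have UL: "L \<union> (U - L) = U" using L by blast
  have "q \<in> ?X \<longleftrightarrow> q \<in> U \<rightarrow>\<^sub>E UNIV \<and> restrict q L \<in> PiE L (\<lambda>u. {c \<in> Q u. ok u c A}) \<and>
        restrict q (U - L) \<in> burning (\<lambda>u. {c \<in> Q u. \<not> ok u c A}) ok (A \<union> L) (U - L)" for q
  proof
    assume q: "q \<in> ?X"
    have "q \<in> U \<rightarrow>\<^sub>E UNIV" using q unfolding burning_def by (auto simp: PiE_def)
    moreover have "restrict q L \<in> PiE L (\<lambda>u. {c \<in> Q u. ok u c A})"
      using q unfolding burning_def by (auto simp: PiE_def)
    moreover have "restrict q (U - L) \<in> burning (\<lambda>u. {c \<in> Q u. \<not> ok u c A}) ok (A \<union> L) (U - L)"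
    proof -
      have "\<exists>u\<in>W. ok u (restrict q (U - L) u) ((A \<union> L) \<union> ((U - L) - W))"
        if W: "W \<subseteq> U - L" "W \<noteq> {}" for W
      proof -
        have "W \<subseteq> U" using W by blast
        then obtain u where u: "u \<in> W" "ok u (q u) (A \<union> (U - W))"
          using q W(2) unfolding burning_def by blast
        have "(A \<union> L) \<union> ((U - L) - W) = A \<union> (U - W)" using W L by blast
        then show ?thesis using u W by auto
      qed
      moreover have "restrict q (U - L) \<in> PiE (U - L) (\<lambda>u. {c \<in> Q u. \<not> ok u c A})"
        using q unfolding burning_def by (auto simp: PiE_def)
      ultimately show ?thesis unfolding burning_def by blast
    qed
    ultimately show "q \<in> U \<rightarrow>\<^sub>E UNIV \<and> restrict q L \<in> PiE L (\<lambda>u. {c \<in> Q u. ok u c A}) \<and>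
        restrict q (U - L) \<in> burning (\<lambda>u. {c \<in> Q u. \<not> ok u c A}) ok (A \<union> L) (U - L)" by blast
  next
    assume q: "q \<in> U \<rightarrow>\<^sub>E UNIV \<and> restrict q L \<in> PiE L (\<lambda>u. {c \<in> Q u. ok u c A}) \<and>
        restrict q (U - L) \<in> burning (\<lambda>u. {c \<in> Q u. \<not> ok u c A}) ok (A \<union> L) (U - L)"
    have 1: "q u \<in> Q u \<and> ok u (q u) A" if "u \<in> L" for u
      using PiE_mem[of "restrict q L" L "\<lambda>u. {c \<in> Q u. ok u c A}" u] q that by simp
    have 2: "q u \<in> Q u \<and> \<not> ok u (q u) A" if "u \<in> U - L" for u
    proof -
      have "restrict q (U - L) \<in> PiE (U - L) (\<lambda>u. {c \<in> Q u. \<not> ok u c A})"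
        using q unfolding burning_def by blast
      from PiE_mem[OF this that] show ?thesis using that by simp
    qed
    have 3: "\<exists>u\<in>W. ok u (q u) (A \<union> (U - W))" if W: "W \<subseteq> U" "W \<noteq> {}" for W
    proof (cases "W \<inter> L = {}")
      case True
      then have "W \<subseteq> U - L" using W by blast
      then obtain u where u: "u \<in> W" "ok u (restrict q (U - L) u) ((A \<union> L) \<union> ((U - L) - W))"
        using q W(2) unfolding burning_def by blast
      have "(A \<union> L) \<union> ((U - L) - W) = A \<union> (U - W)" using True L by blast
      moreover have "u \<in> U - L" using u(1) \<open>W \<subseteq> U - L\<close> by blast
      ultimately show ?thesis using u by auto
    next
      case False
      then obtain u where "u \<in> W" "u \<in> L" by blast
      then show ?thesis using 1 monoD[OF mono, of A "A \<union> (U - W)" u "q u"] by auto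
    qed
    have "q \<in> PiE U Q" using q 1 2 L by (auto simp: PiE_def)
    moreover have "{u \<in> U. ok u (q u) A} = L" using 1 2 L by blast
    ultimately show "q \<in> ?X" using 3 unfolding burning_def by blast
  qed
  then show ?thesis using False UL by auto
qed

text \<open>Testing singletons \<open>W = {u}\<close> shows, with monotonicity, that only choices
  which are ok at \<open>A \<union> U\<close> occur.\<close>

lemma finite_burning:
  assumes "finite U" and mono: "\<And>u c. mono (ok u c)"
    and "\<And>u. u \<in> U \<Longrightarrow> finite {c \<in> Q u. ok u c (A \<union> U)}"
  shows "finite (burning Q ok A U)"
proof (rule finite_subset)
  show "finite (PiE U (\<lambda>u. {c \<in> Q u. ok u c (A \<union> U)}))"
    using assms by (intro finite_PiE) auto
  have "ok u (q u) (A \<union> U)" if q: "q \<in> burning Q ok A U" and u: "u \<in> U" for q u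
  proof -
    have "\<exists>w\<in>{u}. ok w (q w) (A \<union> (U - {u}))" using q u unfolding burning_def by blast
    then show ?thesis using monoD[OF mono, of "A \<union> (U - {u})" "A \<union> U" u "q u"] by auto
  qed
  then show "burning Q ok A U \<subseteq> PiE U (\<lambda>u. {c \<in> Q u. ok u c (A \<union> U)})"
    by (auto simp: burning_def PiE_def Pi_def)
qed

lemma card_burning:
  assumes mono: "\<And>u c. mono (ok u c)"
    and U: "finite U" "U \<noteq> {}"
    and fin: "\<And>u. u \<in> U \<Longrightarrow> finite {c \<in> Q u. ok u c (A \<union> U)}"
  shows "card (burning Q ok A U) = (\<Sum>L\<in>Pow U - {{}}. (\<Prod>u\<in>L. card {c \<in> Q u. ok u c A}) *
      card (burning (\<lambda>u. {c \<in> Q u. \<not> ok u c A}) ok (A \<union> L) (U - L)))"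
proof -
  let ?X = "\<lambda>L. {q \<in> burning Q ok A U. {u \<in> U. ok u (q u) A} = L}"
  have finB: "finite (burning Q ok A U)"
    by (rule finite_burning[OF U(1) mono fin])
  have "card (burning Q ok A U) = card (\<Union>L\<in>Pow U. ?X L)"
    by (rule arg_cong[where f = card], rule set_eqI) simp
  also have "\<dots> = (\<Sum>L\<in>Pow U. card (?X L))"
    using U finB by (intro card_UN_disjoint) auto
  also have "\<dots> = (\<Sum>L\<in>Pow U - {{}}. card (?X L))"
  proof (rule sum.mono_neutral_right)
    have "?X {} = {}"
      using burning_layer[where ok = ok and L = "{}" and U = U and Q = Q and A = A, OF mono] U
      by simp
    then have "card (?X {}) = 0" by (simp only: card.empty)
    then show "\<forall>L\<in>Pow U - (Pow U - {{}}). card (?X L) = 0" by blast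
  qed (use U in auto)
  also have "\<dots> = (\<Sum>L\<in>Pow U - {{}}. (\<Prod>u\<in>L. card {c \<in> Q u. ok u c A}) *
      card (burning (\<lambda>u. {c \<in> Q u. \<not> ok u c A}) ok (A \<union> L) (U - L)))"
  proof (rule sum.cong[OF refl])
    fix L assume L: "L \<in> Pow U - {{}}"
    then have finL: "finite L" using rev_finite_subset[OF U(1), of L] by simp
    let ?P = "PiE L (\<lambda>u. {c \<in> Q u. ok u c A})"
    let ?B = "burning (\<lambda>u. {c \<in> Q u. \<not> ok u c A}) ok (A \<union> L) (U - L)"
    have "?X L = {q \<in> (L \<union> (U - L)) \<rightarrow>\<^sub>E UNIV. restrict q L \<in> ?P \<and> restrict q (U - L) \<in> ?B}"
      using burning_layer[where ok = ok and L = L and U = U and Q = Q and A = A, OF mono] L by simp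
    also have "card \<dots> = card ?P * card ?B"
      by (rule card_PiE_split) (auto simp: burning_def PiE_def)
    also have "card ?P = (\<Prod>u\<in>L. card {c \<in> Q u. ok u c A})"
      by (rule card_PiE[OF finL])
    finally show "card (?X L) = (\<Prod>u\<in>L. card {c \<in> Q u. ok u c A}) * card ?B" .
  qed
  finally show ?thesis .
qed

text \<open>The recursion of \<open>card_burning\<close> involves the choices only through their
  numbers, so induction on the size of \<open>U\<close> applies as soon as the residual systems
  satisfy the hypothesis too. They do because equality is assumed for every \<open>B\<close> between
  \<open>A\<close> and \<open>A \<union> U\<close>, not for one set only.\<close>

theorem card_burning_eq:
  assumes "finite U"
    and "\<And>u c. mono (ok1 u c)" and "\<And>u c. mono (ok2 u c)"
    and "\<And>u. u \<in> U \<Longrightarrow> finite {c \<in> Q1 u. ok1 u c (A \<union> U)}"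
    and "\<And>u. u \<in> U \<Longrightarrow> finite {c \<in> Q2 u. ok2 u c (A \<union> U)}"
    and "\<And>u B. u \<in> U \<Longrightarrow> A \<subseteq> B \<Longrightarrow> B \<subseteq> A \<union> U \<Longrightarrow>
           card {c \<in> Q1 u. ok1 u c B} = card {c \<in> Q2 u. ok2 u c B}"
  shows "card (burning Q1 ok1 A U) = card (burning Q2 ok2 A U)"
  using assms(1,4-6)
proof (induction "card U" arbitrary: U A Q1 Q2 rule: less_induct)
  case less
  note mono1 = assms(2) and mono2 = assms(3)
  show ?case
  proof (cases "U = {}")
    case True
    then show ?thesis by (simp add: burning_def)
  next
    case False
    have "card (burning (\<lambda>u. {c \<in> Q1 u. \<not> ok1 u c A}) ok1 (A \<union> L) (U - L)) =
          card (burning (\<lambda>u. {c \<in> Q2 u. \<not> ok2 u c A}) ok2 (A \<union> L) (U - L))"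
      if L: "L \<subseteq> U" "L \<noteq> {}" for L
    proof (rule less.hyps)
      show "card (U - L) < card U"
        using L less.prems(1) by (intro psubset_card_mono) auto
      show "finite (U - L)" using less.prems(1) by simp
      have AU: "A \<union> L \<union> (U - L) = A \<union> U" using L by blast
      show "finite {c \<in> {c \<in> Q1 u. \<not> ok1 u c A}. ok1 u c (A \<union> L \<union> (U - L))}"
        if "u \<in> U - L" for u
        unfolding AU by (rule finite_subset[OF _ less.prems(2)[of u]]) (use that in auto)
      show "finite {c \<in> {c \<in> Q2 u. \<not> ok2 u c A}. ok2 u c (A \<union> L \<union> (U - L))}"
        if "u \<in> U - L" for u
        unfolding AU by (rule finite_subset[OF _ less.prems(3)[of u]]) (use that in auto)
      fix u B assume u: "u \<in> U - L" and B: "A \<union> L \<subseteq> B" "B \<subseteq> A \<union> L \<union> (U - L)"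
      have B': "A \<subseteq> B" "B \<subseteq> A \<union> U" using B AU by auto
      \<comment> \<open>By monotonicity the choices discarded at \<open>A\<close> are among those
        that are ok at \<open>B\<close>, so a residual count is a difference of two counts covered
        by the hypothesis.\<close>
      have *: "card {c \<in> {c \<in> Q u. \<not> ok u c A}. ok u c B}
            = card {c \<in> Q u. ok u c B} - card {c \<in> Q u. ok u c A}"
        if m: "\<And>u c. mono (ok u c)"
          and f: "finite {c \<in> Q u. ok u c (A \<union> U)}"
        for Q :: "'a \<Rightarrow> 'd set" and ok
      proof -
        have "{c \<in> {c \<in> Q u. \<not> ok u c A}. ok u c B}
            = {c \<in> Q u. ok u c B} - {c \<in> Q u. ok u c A}" by auto
        moreover have "{c \<in> Q u. ok u c A} \<subseteq> {c \<in> Q u. ok u c B}" using monoD[OF m B'(1)] by auto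
        moreover have "finite {c \<in> Q u. ok u c A}"
          by (rule finite_subset[OF _ f]) (use monoD[OF m, of A "A \<union> U"] in auto)
        ultimately show ?thesis by (simp add: card_Diff_subset)
      qed
      show "card {c \<in> {c \<in> Q1 u. \<not> ok1 u c A}. ok1 u c B} =
            card {c \<in> {c \<in> Q2 u. \<not> ok2 u c A}. ok2 u c B}"
        using *[of ok1 Q1, OF mono1] *[of ok2 Q2, OF mono2] less.prems(2-4) u B' by simp
    qed
    moreover have "(\<Prod>u\<in>L. card {c \<in> Q1 u. ok1 u c A}) = (\<Prod>u\<in>L. card {c \<in> Q2 u. ok2 u c A})"
      if "L \<subseteq> U" for L
      using that less.prems(4) by (intro prod.cong) auto
    ultimately have "(\<Sum>L\<in>Pow U - {{}}. (\<Prod>u\<in>L. card {c \<in> Q1 u. ok1 u c A}) *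
          card (burning (\<lambda>u. {c \<in> Q1 u. \<not> ok1 u c A}) ok1 (A \<union> L) (U - L))) =
        (\<Sum>L\<in>Pow U - {{}}. (\<Prod>u\<in>L. card {c \<in> Q2 u. ok2 u c A}) *
          card (burning (\<lambda>u. {c \<in> Q2 u. \<not> ok2 u c A}) ok2 (A \<union> L) (U - L)))"
      by (intro sum.cong) auto
    then show ?thesis
      using card_burning[of ok1, OF mono1 less.prems(1) False less.prems(2)]
        card_burning[of ok2, OF mono2 less.prems(1) False less.prems(3)] by presburger
  qed
qed


section \<open>Firing\<close>

lemma
  assumes "fin_simple_graph G"
  shows nbrs_subset: "nbrs G u \<subseteq> uverts G"
    and nbrs_irrefl: "u \<notin> nbrs G u"
    and finite_nbrs: "finite (nbrs G u)"
proof -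
  show s: "nbrs G u \<subseteq> uverts G" using assms unfolding fin_simple_graph_def nbrs_def by blast
  show "u \<notin> nbrs G u" using assms unfolding fin_simple_graph_def nbrs_def by force
  show "finite (nbrs G u)" using s assms finite_subset unfolding fin_simple_graph_def by blast
qed

lemma nbrs_sym: "u \<in> nbrs G w \<longleftrightarrow> w \<in> nbrs G u"
  by (simp add: nbrs_def insert_commute)

lemma card_nbrs_Int_le: "fin_simple_graph G \<Longrightarrow> card (nbrs G u \<inter> F) \<le> deg G u"
  unfolding deg_def by (intro card_mono finite_nbrs) auto

lemma card_nbrs_Int_mono:
  "fin_simple_graph G \<Longrightarrow> F \<subseteq> F' \<Longrightarrow> card (nbrs G u \<inter> F) \<le> card (nbrs G u \<inter> F')"
  by (intro card_mono) (auto simp: finite_nbrs)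

text \<open>This says that the vertices of \<open>S\<close> can be fired once each in a suitable
  order: \<open>W\<close> stands for those that have not fired yet, and the vertex found in
  \<open>W\<close> can fire next.\<close>

definition burnable :: "'a ugraph \<Rightarrow> ('a \<Rightarrow> nat) \<Rightarrow> 'a set \<Rightarrow> bool" where
  "burnable G C S \<longleftrightarrow> S \<subseteq> uverts G \<and>
     (\<forall>W\<subseteq>S. W \<noteq> {} \<longrightarrow> (\<exists>u\<in>W. deg G u < C u + card (nbrs G u \<inter> (S - W))))"

text \<open>\<open>D\<close> arises from \<open>C\<close> by firing each vertex of \<open>F\<close> once; the chips lost by firing are on the
  left-hand side because subtraction truncates.\<close>

definition fired :: "'a ugraph \<Rightarrow> ('a \<Rightarrow> nat) \<Rightarrow> 'a set \<Rightarrow> ('a \<Rightarrow> nat) \<Rightarrow> bool" where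
  "fired G C F D \<longleftrightarrow>
     (\<forall>u. D u + (if u \<in> F then deg G u + 1 else 0) = C u + card (nbrs G u \<inter> F))"

lemma fired_fire:
  assumes G: "fin_simple_graph G" and f: "fired G C F D" and x: "x \<notin> F" "can_fire G D x"
  shows "fired G C (insert x F) (fire G x D)"
  unfolding fired_def
proof
  fix u
  have D: "D u + (if u \<in> F then deg G u + 1 else 0) = C u + card (nbrs G u \<inter> F)"
    using f unfolding fired_def by blast
  have c: "card (nbrs G u \<inter> insert x F) = card (nbrs G u \<inter> F) + (if u \<in> nbrs G x then 1 else 0)"
  proof (cases "u \<in> nbrs G x")
    case True
    then have "nbrs G u \<inter> insert x F = insert x (nbrs G u \<inter> F)" using nbrs_sym by fastforce
    then show ?thesis using True x(1) finite_nbrs[OF G] by simp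
  next
    case False
    then have "nbrs G u \<inter> insert x F = nbrs G u \<inter> F" using nbrs_sym by fastforce
    then show ?thesis using False by simp
  qed
  show "fire G x D u + (if u \<in> insert x F then deg G u + 1 else 0)
      = C u + card (nbrs G u \<inter> insert x F)"
    unfolding c using D x nbrs_irrefl[OF G] by (auto simp: fire_def can_fire_def)
qed

lemma burnable_fires:
  assumes G: "fin_simple_graph G" and b: "burnable G C S" and "n \<le> card S"
  shows "\<exists>F D. F \<subseteq> S \<and> card F = n \<and> (fire_step G ^^ n) C D \<and> fired G C F D"
  using assms(3)
proof (induction n)
  case 0
  show ?case by (intro exI[of _ "{}"] exI[of _ C]) (auto simp: fired_def)
next
  case (Suc n)
  then obtain F D where F: "F \<subseteq> S" "card F = n" "(fire_step G ^^ n) C D" "fired G C F D"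
    by auto
  have finS: "finite S" using G b finite_subset unfolding burnable_def fin_simple_graph_def by blast
  \<comment> \<open>Burnability is applied to the set of vertices still to be fired. The vertex
    \<open>u\<close> found there has lost no chips so far, so its count in \<open>D\<close> is
    \<open>C u\<close> plus what \<open>F\<close> has sent.\<close>
  then have "S - F \<noteq> {}" "S - F \<subseteq> S" "S - (S - F) = F" using F Suc.prems by auto
  then obtain u where u: "u \<in> S - F" "deg G u < C u + card (nbrs G u \<inter> F)"
    using b unfolding burnable_def by metis
  have "D u + (if u \<in> F then deg G u + 1 else 0) = C u + card (nbrs G u \<inter> F)"
    using F(4) unfolding fired_def by blast
  then have "D u = C u + card (nbrs G u \<inter> F)" using u(1) by simp
  then have cf: "can_fire G D u" using u b unfolding can_fire_def burnable_def by auto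
  show ?case
  proof (intro exI conjI)
    show "insert u F \<subseteq> S" using F u by auto
    show "card (insert u F) = Suc n" using F u finS finite_subset[OF F(1)] by simp
    show "fired G C (insert u F) (fire G u D)" using fired_fire[OF G F(4) _ cf] u by simp
    have "fire_step G D (fire G u D)" using cf unfolding fire_step_def by blast
    with F(3) show "(fire_step G ^^ Suc n) C (fire G u D)" by auto
  qed
qed

lemma burnable_fires_all:
  assumes "fin_simple_graph G" "burnable G C S"
  shows "\<exists>D. (fire_step G ^^ card S) C D \<and> fired G C S D"
proof -
  have "finite S" using assms finite_subset unfolding burnable_def fin_simple_graph_def by blast
  then show ?thesis using burnable_fires[OF assms order_refl] card_subset_eq by metis
qed

text \<open>This is where repeated firing is excluded. The bound deg + 1 leaves room for the seed
  chip.\<close>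

lemma fires_burnable:
  assumes G: "fin_simple_graph G" and C: "\<And>u. u \<in> uverts G \<Longrightarrow> C u \<le> deg G u + 1"
    and "(fire_step G ^^ n) C D"
  shows "\<exists>F. burnable G C F \<and> card F = n \<and> fired G C F D"
  using assms(3)
proof (induction n arbitrary: D)
  case 0
  then show ?case by (intro exI[of _ "{}"]) (auto simp: burnable_def fired_def)
next
  case (Suc n)
  then obtain D' where "(fire_step G ^^ n) C D'" "fire_step G D' D" by auto
  then obtain F x where F: "burnable G C F" "card F = n" "fired G C F D'"
    and x: "can_fire G D' x" "D = fire G x D'" using Suc.IH unfolding fire_step_def by blast
  have xV: "x \<in> uverts G" and Dx: "deg G x < D' x" using x unfolding can_fire_def by auto
  have fx: "D' x + (if x \<in> F then deg G x + 1 else 0) = C x + card (nbrs G x \<inter> F)"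
    using F(3) unfolding fired_def by blast
  \<comment> \<open>If \<open>x\<close> had fired before, it would now hold at most (deg + 1) + deg
    - (deg + 1) = deg chips.\<close>
  have xF: "x \<notin> F"
    using fx C[OF xV] Dx card_nbrs_Int_le[OF G, of x F] by auto
  have finF: "finite F"
    using G F finite_subset unfolding burnable_def fin_simple_graph_def by blast
  have "\<exists>u\<in>W. deg G u < C u + card (nbrs G u \<inter> (insert x F - W))"
    if W: "W \<subseteq> insert x F" "W \<noteq> {}" for W
  proof (cases "W = {x}")
    case True
    then show ?thesis using fx xF Dx by simp
  next
    case False
    then have "W - {x} \<subseteq> F" "W - {x} \<noteq> {}" using W by auto
    then obtain u where u: "u \<in> W - {x}" "deg G u < C u + card (nbrs G u \<inter> (F - (W - {x})))"
      using F(1) unfolding burnable_def by meson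
    have "F - (W - {x}) \<subseteq> insert x F - W" using xF by blast
    from card_nbrs_Int_mono[OF G this, of u] u show ?thesis by force
  qed
  then have "burnable G C (insert x F)" using F(1) xV unfolding burnable_def by auto
  then show ?case
    using fired_fire[OF G F(3) xF x(1)] x(2) xF finF F(2) by (intro exI[of _ "insert x F"]) simp
qed

section \<open>The set of vertices that fire\<close>

definition burnt_set :: "'a ugraph \<Rightarrow> ('a \<Rightarrow> nat) \<Rightarrow> 'a set \<Rightarrow> bool" where
  "burnt_set G C S \<longleftrightarrow> burnable G C S \<and>
     (\<forall>u\<in>uverts G - S. C u + card (nbrs G u \<inter> S) \<le> deg G u)"

text \<open>Among the vertices of \<open>S - S'\<close>, the one that burns first needs only
  neighbours in \<open>S \<inter> S'\<close>, so it could still fire after \<open>S'\<close>. Thus a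
  burnt set is the largest burnable set; its uniqueness takes the place of a confluence argument for
  firing sequences.\<close>

lemma burnt_set_subset:
  assumes G: "fin_simple_graph G" and "burnable G C S" "burnt_set G C S'"
  shows "S \<subseteq> S'"
proof (rule ccontr)
  assume "\<not> S \<subseteq> S'"
  then have "S - S' \<noteq> {}" "S - S' \<subseteq> S" by auto
  then obtain u where u: "u \<in> S - S'" "deg G u < C u + card (nbrs G u \<inter> (S - (S - S')))"
    using assms(2) unfolding burnable_def by meson
  have "card (nbrs G u \<inter> (S - (S - S'))) \<le> card (nbrs G u \<inter> S')"
    by (rule card_nbrs_Int_mono[OF G]) auto
  moreover have "u \<in> uverts G - S'" using u assms(2) unfolding burnable_def by auto
  ultimately show False using u assms(3) unfolding burnt_set_def by force
qed

lemma burnt_set_unique: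
  assumes "fin_simple_graph G" "burnt_set G C S" "burnt_set G C S'"
  shows "S = S'"
  using burnt_set_subset[OF assms(1)] assms(2,3) unfolding burnt_set_def
  by (metis subset_antisym)

lemma relaxedD: "relaxed G C \<Longrightarrow> u \<in> uverts G \<Longrightarrow> C u \<le> deg G u"
  by (auto simp: relaxed_def can_fire_def not_less)

lemma burn_off_iff:
  assumes G: "fin_simple_graph G" and C: "relaxed G C"
  shows "burn_off_game_length G C v l \<longleftrightarrow> (\<exists>S. burnt_set G (C(v := C v + 1)) S \<and> card S = l)"
proof -
  let ?C = "C(v := C v + 1)"
  have C1: "?C u \<le> deg G u + 1" if "u \<in> uverts G" for u
    using relaxedD[OF C that] by auto
  have *: "relaxed G D \<longleftrightarrow> (\<forall>u\<in>uverts G - S. ?C u + card (nbrs G u \<inter> S) \<le> deg G u)"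
    if D: "fired G ?C S D" for S D
  proof -
    have e: "D u + (if u \<in> S then deg G u + 1 else 0) = ?C u + card (nbrs G u \<inter> S)" for u
      using D unfolding fired_def by blast
    \<comment> \<open>The count that excludes a second firing shows that only vertices outside
      \<open>S\<close> can obstruct relaxedness.\<close>
    have "D u \<le> deg G u" if "u \<in> S" "u \<in> uverts G" for u
      using e[of u] C1[of u] card_nbrs_Int_le[OF G, of u S] that by simp
    moreover have "D u = ?C u + card (nbrs G u \<inter> S)" if "u \<notin> S" for u
      using e[of u] that by simp
    ultimately show ?thesis
      unfolding relaxed_def can_fire_def by (metis DiffD1 DiffD2 DiffI not_le)
  qed
  show ?thesis
  proof
    assume "burn_off_game_length G C v l"
    then obtain D where "(fire_step G ^^ l) ?C D" "relaxed G D"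
      unfolding burn_off_game_length_def by blast
    moreover from fires_burnable[OF G C1 this(1)] obtain S where
      "burnable G ?C S" "card S = l" "fired G ?C S D" by blast
    ultimately show "\<exists>S. burnt_set G ?C S \<and> card S = l"
      using * unfolding burnt_set_def by blast
  next
    assume "\<exists>S. burnt_set G ?C S \<and> card S = l"
    then obtain S where S: "burnt_set G ?C S" "card S = l" by blast
    then obtain D where "(fire_step G ^^ l) ?C D" "fired G ?C S D"
      using burnable_fires_all[OF G] unfolding burnt_set_def by blast
    then show "burn_off_game_length G C v l"
      using * S unfolding burn_off_game_length_def burnt_set_def by blast
  qed
qed


section \<open>Legal configurations\<close>

text \<open>Dhar's criterion: legality is the absence of forbidden subconfigurations.\<close>

definition allowed :: "'a ugraph \<Rightarrow> ('a \<Rightarrow> nat) \<Rightarrow> bool" where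
  "allowed G C \<longleftrightarrow> (\<forall>W\<subseteq>uverts G. W \<noteq> {} \<longrightarrow> (\<exists>u\<in>W. card (nbrs G u \<inter> W) \<le> C u))"

lemma allowed_mono: "allowed G C \<Longrightarrow> (\<And>u. C u \<le> D u) \<Longrightarrow> allowed G D"
  unfolding allowed_def by (meson le_trans)

text \<open>For u distinct from x, undoing the reverse-firing returns one chip exactly when u is
  adjacent to x. Adding x to a test set raises the degree of u inside that set by at most the same
  amount, so the test for \<open>W - {x}\<close> yields the one for \<open>W\<close>.\<close>

lemma allowed_rev_fire:
  assumes G: "fin_simple_graph G" and x: "can_rev_fire G C x" and a: "allowed G (rev_fire G x C)"
  shows "allowed G C"
  unfolding allowed_def
proof (intro allI impI)
  fix W assume W: "W \<subseteq> uverts G" "W \<noteq> {}"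
  let ?D = "rev_fire G x C"
  have D: "C u = ?D u + (if u \<in> nbrs G x then 1 else 0)" if "u \<noteq> x" for u
    using x that unfolding rev_fire_def can_rev_fire_def by auto
  show "\<exists>u\<in>W. card (nbrs G u \<inter> W) \<le> C u"
  proof (cases "W = {x}")
    case True
    then show ?thesis using nbrs_irrefl[OF G, of x] by simp
  next
    case False
    then have "W - {x} \<subseteq> uverts G" "W - {x} \<noteq> {}" using W by auto
    then obtain u where u: "u \<in> W - {x}" "card (nbrs G u \<inter> (W - {x})) \<le> ?D u"
      using a unfolding allowed_def by meson
    have "card (nbrs G u \<inter> W) \<le> card (nbrs G u \<inter> (W - {x})) + (if u \<in> nbrs G x then 1 else 0)"
    proof (cases "u \<in> nbrs G x")
      case True
      have "nbrs G u \<inter> W \<subseteq> insert x (nbrs G u \<inter> (W - {x}))" by blast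
      then have "card (nbrs G u \<inter> W) \<le> card (insert x (nbrs G u \<inter> (W - {x})))"
        by (intro card_mono) (auto simp: finite_nbrs[OF G])
      then show ?thesis using True by (simp add: finite_nbrs[OF G])
    next
      case False
      then have "nbrs G u \<inter> W = nbrs G u \<inter> (W - {x})" using nbrs_sym by fastforce
      then show ?thesis by simp
    qed
    then show ?thesis using u D[of u] by force
  qed
qed

lemma rev_fire_step_fire_step:
  assumes G: "fin_simple_graph G" and "fire_step G C D"
  shows "rev_fire_step G D C"
proof -
  obtain x where x: "can_fire G C x" "D = fire G x C" using assms unfolding fire_step_def by blast
  have "can_rev_fire G D x"
    using x nbrs_irrefl[OF G, of x] unfolding can_rev_fire_def can_fire_def fire_def by auto
  moreover have "C = rev_fire G x D"
    using x nbrs_irrefl[OF G, of x] unfolding rev_fire_def can_fire_def fire_def by auto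
  ultimately show ?thesis unfolding rev_fire_step_def by blast
qed

text \<open>Firing every vertex once removes exactly one chip from each vertex.\<close>

lemma allowed_rev_fire_add:
  assumes G: "fin_simple_graph G" and a: "allowed G C"
  shows "(rev_fire_step G)\<^sup>*\<^sup>* C (\<lambda>u. if u \<in> uverts G then C u + 1 else C u)"
proof -
  let ?V = "uverts G" and ?C = "\<lambda>u. if u \<in> uverts G then C u + 1 else C u"
  have c: "card (nbrs G u \<inter> W) + card (nbrs G u \<inter> (?V - W)) = deg G u" if "W \<subseteq> ?V" for u W
  proof -
    have "nbrs G u = (nbrs G u \<inter> W) \<union> (nbrs G u \<inter> (?V - W))"
      using nbrs_subset[OF G, of u] by blast
    then have "deg G u = card ((nbrs G u \<inter> W) \<union> (nbrs G u \<inter> (?V - W)))"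
      unfolding deg_def by simp
    also have "\<dots> = card (nbrs G u \<inter> W) + card (nbrs G u \<inter> (?V - W))"
      by (rule card_Un_disjoint) (auto simp: finite_nbrs[OF G])
    finally show ?thesis by simp
  qed
  \<comment> \<open>Degrees into \<open>W\<close> and into its complement add up to deg, so Dhar's
    condition at \<open>u\<close> becomes burnability; the additional chip makes the inequality
    strict.\<close>
  have "burnable G ?C ?V"
    unfolding burnable_def
  proof (intro conjI allI impI)
    fix W assume W: "W \<subseteq> ?V" "W \<noteq> {}"
    then obtain u where u: "u \<in> W" "card (nbrs G u \<inter> W) \<le> C u"
      using a unfolding allowed_def by meson
    then show "\<exists>u\<in>W. deg G u < ?C u + card (nbrs G u \<inter> (?V - W))"
      using c[OF W(1), of u] W by (intro bexI[of _ u]) auto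
  qed simp
  then obtain D where D: "(fire_step G ^^ card ?V) ?C D" "fired G ?C ?V D"
    using burnable_fires_all[OF G] by blast
  have "D = C"
  proof
    fix u
    have "D u + (if u \<in> ?V then deg G u + 1 else 0) = ?C u + card (nbrs G u \<inter> ?V)"
      using D(2) unfolding fired_def by blast
    moreover have "nbrs G u = {}" if "u \<notin> ?V"
      using that nbrs_subset[OF G] nbrs_sym by fastforce
    moreover have "card (nbrs G u \<inter> ?V) = deg G u" using c[of ?V u] by simp
    ultimately show "D u = C u" by (auto split: if_splits)
  qed
  moreover have "(rev_fire_step G)\<^sup>*\<^sup>* D' C'" if "(fire_step G ^^ n) C' D'" for n C' D'
    using that
  proof (induction n arbitrary: D')
    case (Suc n)
    then obtain E where "(fire_step G ^^ n) C' E" "fire_step G E D'" by auto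
    then show ?case
      using Suc.IH rev_fire_step_fire_step[OF G] by (meson converse_rtranclp_into_rtranclp)
  qed simp
  ultimately show ?thesis using D(1) by blast
qed

text \<open>Supercritical configurations are allowed, since a degree inside \<open>W\<close> never
  exceeds deg, and this travels back along reverse-firings. For the converse, rounds in which every
  vertex is reverse-fired once add one chip everywhere and keep the configuration allowed.\<close>

lemma legal_iff_allowed:
  assumes G: "fin_simple_graph G"
  shows "legal G C \<longleftrightarrow> allowed G C"
proof
  assume "legal G C"
  then obtain D where D: "(rev_fire_step G)\<^sup>*\<^sup>* C D" "supercritical G D"
    unfolding legal_def by blast
  have "allowed G D"
    unfolding allowed_def
  proof (intro allI impI)
    fix W assume W: "W \<subseteq> uverts G" "W \<noteq> {}"
    then obtain u where "u \<in> W" by blast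
    then show "\<exists>u\<in>W. card (nbrs G u \<inter> W) \<le> D u"
      using W D(2) card_nbrs_Int_le[OF G, of u W] unfolding supercritical_def by force
  qed
  with D(1) show "allowed G C"
    by (induction rule: converse_rtranclp_induct)
      (auto simp: rev_fire_step_def dest: allowed_rev_fire[OF G])
next
  assume a: "allowed G C"
  let ?C = "\<lambda>n u. if u \<in> uverts G then C u + n else C u"
  have "(rev_fire_step G)\<^sup>*\<^sup>* C (?C n)" for n
  proof (induction n)
    case (Suc n)
    have "allowed G (?C n)" by (rule allowed_mono[OF a]) simp
    moreover have "?C (Suc n) = (\<lambda>u. if u \<in> uverts G then ?C n u + 1 else ?C n u)" by auto
    ultimately have "(rev_fire_step G)\<^sup>*\<^sup>* (?C n) (?C (Suc n))"
      using allowed_rev_fire_add[OF G, of "?C n"] by argo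
    with Suc show ?case by (rule rtranclp_trans)
  next
    case 0
    have "?C 0 = C" by auto
    then show ?case by (simp only: rtranclp.rtrancl_refl)
  qed
  \<comment> \<open>No degree exceeds the number of vertices, so one round more than that number is
    enough.\<close>
  moreover have "supercritical G (?C (Suc (card (uverts G))))"
  proof -
    have "finite (uverts G)" using G unfolding fin_simple_graph_def by blast
    then have "deg G u \<le> card (uverts G)" for u
      unfolding deg_def by (intro card_mono nbrs_subset[OF G])
    then show ?thesis unfolding supercritical_def by (simp add: le_imp_less_Suc trans_le_add2)
  qed
  ultimately show "legal G C" unfolding legal_def by blast
qed

lemma relaxed_legal_iff:
  assumes "fin_simple_graph G"
  shows "C \<in> relaxed_legal G \<longleftrightarrow>
    C \<in> uverts G \<rightarrow>\<^sub>E UNIV \<and> (\<forall>u\<in>uverts G. C u \<le> deg G u) \<and> allowed G C"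
  unfolding relaxed_legal_def configs_def relaxed_def can_fire_def
  using legal_iff_allowed[OF assms] by (auto simp: not_less)

lemma finite_relaxed_legal:
  assumes "fin_simple_graph G"
  shows "finite (relaxed_legal G)"
proof (rule finite_subset)
  show "relaxed_legal G \<subseteq> PiE (uverts G) (\<lambda>u. {..deg G u})"
    using relaxed_legal_iff[OF assms] by (auto simp: PiE_def)
  show "finite (PiE (uverts G) (\<lambda>u. {..deg G u}))"
    using assms unfolding fin_simple_graph_def by (intro finite_PiE) auto
qed

lemma fin_simple_graph_del: "fin_simple_graph G \<Longrightarrow> fin_simple_graph (del_uverts G W)"
  unfolding fin_simple_graph_def del_uverts_def by auto

lemma nbrs_del: "u \<notin> W \<Longrightarrow> nbrs (del_uverts G W) u = nbrs G u - W"
  unfolding nbrs_def del_uverts_def by auto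


section \<open>Configurations with a given burnt set\<close>

text \<open>In both systems below the root \<open>v\<close> burns unconditionally: by having \<open>deg G v\<close> chips before it
  is seeded, respectively by being its own parent.\<close>

definition chip_values :: "'a ugraph \<Rightarrow> 'a \<Rightarrow> 'a \<Rightarrow> nat set" where
  "chip_values G v u = (if u = v then {deg G v} else {..deg G u})"

definition chip_ok :: "'a ugraph \<Rightarrow> 'a \<Rightarrow> 'a \<Rightarrow> nat \<Rightarrow> 'a set \<Rightarrow> bool" where
  "chip_ok G v u c B \<longleftrightarrow> u = v \<or> deg G u < c + card (nbrs G u \<inter> B)"

definition parent_values :: "'a ugraph \<Rightarrow> 'a \<Rightarrow> 'a \<Rightarrow> 'a set" where
  "parent_values G v u = (if u = v then {v} else nbrs G u)"

definition parent_ok :: "'a ugraph \<Rightarrow> 'a \<Rightarrow> 'a \<Rightarrow> 'a \<Rightarrow> 'a set \<Rightarrow> bool" where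
  "parent_ok G v u p B \<longleftrightarrow> u = v \<or> p \<in> B"

lemma card_chip_eq_card_parent:
  assumes G: "fin_simple_graph G" and "finite S"
  shows "card (burning (chip_values G v) (chip_ok G v) {} S) =
         card (burning (parent_values G v) (parent_ok G v) {} S)"
proof (rule card_burning_eq[OF \<open>finite S\<close>])
  show "mono (chip_ok G v u c)" for u c
    using card_nbrs_Int_mono[OF G, of _ _ u] unfolding chip_ok_def
    by (intro monoI le_boolI) (auto intro: less_le_trans)
  show "mono (parent_ok G v u c)" for u c
    unfolding parent_ok_def by (intro monoI le_boolI) auto
  show "finite {c \<in> chip_values G v u. chip_ok G v u c ({} \<union> S)}" for u
    unfolding chip_values_def by simp
  show "finite {c \<in> parent_values G v u. parent_ok G v u c ({} \<union> S)}" for u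
    unfolding parent_values_def using finite_nbrs[OF G] by simp
  fix u B
  show "card {c \<in> chip_values G v u. chip_ok G v u c B} =
        card {c \<in> parent_values G v u. parent_ok G v u c B}"
  proof (cases "u = v")
    case True
    then show ?thesis
      by (simp add: chip_values_def chip_ok_def parent_values_def parent_ok_def)
  next
    case False
    let ?k = "card (nbrs G u \<inter> B)"
    \<comment> \<open>These are the \<open>?k\<close> largest values; the subtraction does not
      truncate because \<open>?k\<close> is at most deg.\<close>
    have "{c \<in> chip_values G v u. chip_ok G v u c B} = {deg G u + 1 - ?k..deg G u}"
      using False by (auto simp: chip_values_def chip_ok_def)
    moreover have "{c \<in> parent_values G v u. parent_ok G v u c B} = nbrs G u \<inter> B"
      using False by (auto simp: parent_values_def parent_ok_def)
    ultimately show ?thesis using card_nbrs_Int_le[OF G, of u B] by simp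
  qed
qed

text \<open>Testing \<open>W = S\<close> yields a vertex that can fire before any other has. In a
  relaxed configuration only the seeded vertex can do so, and only if it was full.\<close>

lemma burnt_set_seed:
  assumes G: "fin_simple_graph G" and C: "\<And>u. u \<in> uverts G \<Longrightarrow> C u \<le> deg G u"
    and S: "burnt_set G (C(v := C v + 1)) S" "S \<noteq> {}"
  shows "v \<in> S" "C v = deg G v"
proof -
  have "\<exists>u\<in>S. deg G u < (C(v := C v + 1)) u + card (nbrs G u \<inter> (S - S))"
    using S unfolding burnt_set_def burnable_def by blast
  then obtain u where u: "u \<in> S" "deg G u < (C(v := C v + 1)) u" by auto
  have "u \<in> uverts G" using S u unfolding burnt_set_def burnable_def by auto
  then have "u = v" "C v = deg G v" using u C[of u] by (auto split: if_splits)
  then show "v \<in> S" "C v = deg G v" using u by auto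
qed

text \<open>Deleting \<open>S\<close> lowers the degree of an outside vertex by its number of
  neighbours in \<open>S\<close>, so resisting the fire and being relaxed in the smaller graph
  coincide. The test sets inside \<open>uverts G - S\<close> see the same neighbours in both
  graphs.\<close>

lemma burnt_set_configs:
  assumes G: "fin_simple_graph G" and S: "S \<subseteq> uverts G" and v: "v \<in> S"
  shows "{C \<in> relaxed_legal G. burnt_set G (C(v := C v + 1)) S} =
    {C \<in> (S \<union> (uverts G - S)) \<rightarrow>\<^sub>E UNIV.
       restrict C S \<in> burning (chip_values G v) (chip_ok G v) {} S \<and>
       restrict C (uverts G - S) \<in> relaxed_legal (del_uverts G S)}"
proof -
  let ?V = "uverts G" and ?H = "del_uverts G S"
  have SV: "S \<union> (?V - S) = ?V" using S by blast
  have VH: "uverts ?H = ?V - S" unfolding del_uverts_def by simp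
  have finS: "finite S" using S G finite_subset unfolding fin_simple_graph_def by blast
  have degH: "deg ?H u + card (nbrs G u \<inter> S) = deg G u" if "u \<notin> S" for u
  proof -
    have "card (nbrs G u - S) = card (nbrs G u) - card (nbrs G u \<inter> S)"
      by (rule card_Diff_subset_Int) (simp add: finite_nbrs[OF G])
    then show ?thesis
      using card_nbrs_Int_le[OF G, of u S] nbrs_del[OF that] unfolding deg_def by simp
  qed
  have nH: "nbrs ?H u \<inter> W = nbrs G u \<inter> W" if "u \<in> W" "W \<subseteq> ?V - S" for u W
    using that nbrs_del[of u S G] by auto
  show ?thesis
  proof (intro set_eqI)
    fix C :: "'a \<Rightarrow> nat"
    let ?C = "C(v := C v + 1)"
    have rH: "restrict C (?V - S) \<in> relaxed_legal ?H \<longleftrightarrow>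
      (\<forall>u\<in>?V - S. C u + card (nbrs G u \<inter> S) \<le> deg G u) \<and>
      (\<forall>W\<subseteq>?V - S. W \<noteq> {} \<longrightarrow> (\<exists>u\<in>W. card (nbrs G u \<inter> W) \<le> C u))"
    proof -
      have "(\<forall>u\<in>?V - S. restrict C (?V - S) u \<le> deg ?H u) \<longleftrightarrow>
          (\<forall>u\<in>?V - S. C u + card (nbrs G u \<inter> S) \<le> deg G u)"
        using degH by (intro ball_cong) (auto, (metis add_le_cancel_right)+)
      moreover have "(\<exists>u\<in>W. card (nbrs ?H u \<inter> W) \<le> restrict C (?V - S) u) \<longleftrightarrow>
          (\<exists>u\<in>W. card (nbrs G u \<inter> W) \<le> C u)" if "W \<subseteq> ?V - S" for W
        using nH[OF _ that] that by (intro bex_cong) auto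
      ultimately show ?thesis
        unfolding relaxed_legal_iff[OF fin_simple_graph_del[OF G]] VH allowed_def by auto
    qed
    have rS: "restrict C S \<in> burning (chip_values G v) (chip_ok G v) {} S \<longleftrightarrow>
      C v = deg G v \<and> (\<forall>u\<in>S. C u \<le> deg G u) \<and> burnable G ?C S"
    proof -
      have "restrict C S \<in> PiE S (chip_values G v) \<longleftrightarrow> C v = deg G v \<and> (\<forall>u\<in>S. C u \<le> deg G u)"
        unfolding restrict_PiE_iff chip_values_def using v
        by (metis atMost_iff order_refl singleton_iff)
      \<comment> \<open>At the root, the seed chip on top of \<open>deg G v\<close> makes the
        right-hand inequality true for every \<open>W\<close>, in agreement with
        \<open>chip_ok\<close>.\<close>
      moreover have *: "(\<exists>u\<in>W. chip_ok G v u (restrict C S u) ({} \<union> (S - W))) \<longleftrightarrow>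
          (\<exists>u\<in>W. deg G u < ?C u + card (nbrs G u \<inter> (S - W)))"
        if "W \<subseteq> S" "C v = deg G v" for W
      proof (intro bex_cong refl)
        fix u assume "u \<in> W"
        then have "u \<in> S" using that by blast
        then show "chip_ok G v u (restrict C S u) ({} \<union> (S - W)) \<longleftrightarrow>
            deg G u < ?C u + card (nbrs G u \<inter> (S - W))"
          using that(2) by (cases "u = v") (simp_all add: chip_ok_def)
      qed
      have "(\<forall>W\<subseteq>S. W \<noteq> {} \<longrightarrow> (\<exists>u\<in>W. chip_ok G v u (restrict C S u) ({} \<union> (S - W)))) \<longleftrightarrow>
          (\<forall>W\<subseteq>S. W \<noteq> {} \<longrightarrow> (\<exists>u\<in>W. deg G u < ?C u + card (nbrs G u \<inter> (S - W))))"
        if "C v = deg G v"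
        by (intro all_cong1 imp_cong[OF refl] * that)
      ultimately show ?thesis
        unfolding burning_def burnable_def mem_Collect_eq using S by argo
    qed
    have al: "allowed G C"
      if b: "burnable G ?C S" and Cv: "C v = deg G v"
        and a: "\<forall>W\<subseteq>?V - S. W \<noteq> {} \<longrightarrow> (\<exists>u\<in>W. card (nbrs G u \<inter> W) \<le> C u)"
      unfolding allowed_def
    proof (intro allI impI)
      fix W assume W: "W \<subseteq> ?V" "W \<noteq> {}"
      show "\<exists>u\<in>W. card (nbrs G u \<inter> W) \<le> C u"
      proof (cases "W \<inter> S = {}")
        case True
        then have "W \<subseteq> ?V - S" using W by blast
        then show ?thesis using a W(2) by blast
      next
        case False
        \<comment> \<open>This \<open>u\<close> burns with the help of \<open>S - W\<close> alone.
          Its neighbours in \<open>W\<close> and in \<open>S - W\<close> number at most deg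
          together, so there are fewer than \<open>?C u\<close> in \<open>W\<close>; strictness
          makes up for the seed chip.\<close>
        then obtain u where u: "u \<in> W \<inter> S" "deg G u < ?C u + card (nbrs G u \<inter> (S - W \<inter> S))"
          using b unfolding burnable_def by (metis inf_le2)
        have "card (nbrs G u \<inter> W) + card (nbrs G u \<inter> (S - W \<inter> S))
            = card (nbrs G u \<inter> W \<union> nbrs G u \<inter> (S - W \<inter> S))"
          by (rule card_Un_disjoint[symmetric]) (auto simp: finite_nbrs[OF G])
        also have "\<dots> \<le> deg G u"
          unfolding deg_def by (intro card_mono finite_nbrs[OF G]) auto
        finally have "card (nbrs G u \<inter> W) + 1 \<le> ?C u" using u(2) by simp
        then show ?thesis using u(1) by (intro bexI[of _ u]) (auto split: if_splits)
      qed
    qed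
    have sub: "\<forall>u\<in>?V - S. ?C u = C u" using v by auto
    have le: "\<forall>u\<in>?V. C u \<le> deg G u"
      if "\<forall>u\<in>S. C u \<le> deg G u" "\<forall>u\<in>?V - S. C u + card (nbrs G u \<inter> S) \<le> deg G u"
      using that by (metis DiffI add_leD1)
    show "C \<in> {C \<in> relaxed_legal G. burnt_set G (C(v := C v + 1)) S} \<longleftrightarrow>
      C \<in> {C \<in> (S \<union> (uverts G - S)) \<rightarrow>\<^sub>E UNIV.
       restrict C S \<in> burning (chip_values G v) (chip_ok G v) {} S \<and>
       restrict C (uverts G - S) \<in> relaxed_legal (del_uverts G S)}" (is "?l \<longleftrightarrow> ?r")
    proof
      assume l: ?l
      then have 1: "C \<in> ?V \<rightarrow>\<^sub>E UNIV" "\<forall>u\<in>?V. C u \<le> deg G u" "allowed G C" "burnt_set G ?C S"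
        using relaxed_legal_iff[OF G] by auto
      have "C v = deg G v" using burnt_set_seed[OF G _ 1(4)] 1(2) v by blast
      moreover have "\<forall>u\<in>S. C u \<le> deg G u" using 1(2) S by blast
      moreover have "\<forall>W\<subseteq>?V - S. W \<noteq> {} \<longrightarrow> (\<exists>u\<in>W. card (nbrs G u \<inter> W) \<le> C u)"
        using 1(3) unfolding allowed_def by blast
      moreover have "\<forall>u\<in>?V - S. C u + card (nbrs G u \<inter> S) \<le> deg G u" "burnable G ?C S"
        using 1(4) sub unfolding burnt_set_def by auto
      ultimately show ?r unfolding mem_Collect_eq SV rH rS using 1(1) by blast
    next
      assume r: ?r
      then have 1: "C \<in> ?V \<rightarrow>\<^sub>E UNIV" "C v = deg G v" "\<forall>u\<in>S. C u \<le> deg G u" "burnable G ?C S"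
        "\<forall>u\<in>?V - S. C u + card (nbrs G u \<inter> S) \<le> deg G u"
        "\<forall>W\<subseteq>?V - S. W \<noteq> {} \<longrightarrow> (\<exists>u\<in>W. card (nbrs G u \<inter> W) \<le> C u)"
        unfolding mem_Collect_eq SV rH rS by blast+
      have "burnt_set G ?C S" unfolding burnt_set_def using 1(4,5) sub by simp
      moreover have "C \<in> relaxed_legal G"
        unfolding relaxed_legal_iff[OF G] using 1(1) le[OF 1(3,5)] al[OF 1(4,2,6)] by blast
      ultimately show ?l by blast
    qed
  qed
qed


section \<open>Parent functions and trees\<close>

definition parent_edges :: "'a set \<Rightarrow> 'a \<Rightarrow> ('a \<Rightarrow> 'a) \<Rightarrow> 'a set set" where
  "parent_edges S v f = (\<lambda>u. {u, f u}) ` (S - {v})"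

text \<open>Pairs run from parent to child, so \<open>wf\<close> says that every chain of successive
  parents is finite. The root is left out because its value under \<open>f\<close> is a
  loop.\<close>

definition parent_rel :: "'a set \<Rightarrow> 'a \<Rightarrow> ('a \<Rightarrow> 'a) \<Rightarrow> ('a \<times> 'a) set" where
  "parent_rel S v f = (\<lambda>u. (f u, u)) ` (S - {v})"

text \<open>The burning condition is the minimal-element form of well-foundedness: the member of
  \<open>W\<close> that burns next is one whose parent lies outside \<open>W\<close>. Sets
  containing the root pass because of the root itself.\<close>

lemma burning_parent_iff:
  assumes "v \<in> S"
  shows "f \<in> burning (parent_values G v) (parent_ok G v) {} S \<longleftrightarrow>
    f \<in> S \<rightarrow>\<^sub>E S \<and> f v = v \<and> (\<forall>u\<in>S - {v}. f u \<in> nbrs G u) \<and> wf (parent_rel S v f)"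
    (is "?l \<longleftrightarrow> ?r")
proof
  assume l: ?l
  have W: "\<exists>u\<in>W. u = v \<or> f u \<in> S - W" if "W \<subseteq> S" "W \<noteq> {}" for W
    using l that unfolding burning_def parent_ok_def by auto
  have P: "f \<in> PiE S (parent_values G v)" using l unfolding burning_def by simp
  have fv: "f v = v" using PiE_mem[OF P assms] by (simp add: parent_values_def)
  have fn: "\<forall>u\<in>S - {v}. f u \<in> nbrs G u"
  proof
    fix u assume "u \<in> S - {v}"
    then show "f u \<in> nbrs G u" using PiE_mem[OF P, of u] by (simp add: parent_values_def)
  qed
  \<comment> \<open>Parents range over all neighbours in \<open>G\<close>; testing
    \<open>W = {u}\<close> forces them into \<open>S\<close>.\<close>
  have "f u \<in> S" if "u \<in> S" for u
    using W[of "{u}"] that fv assms by auto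
  moreover have "wf (parent_rel S v f)"
    unfolding wf_eq_minimal
  proof (intro allI impI)
    fix Q :: "'a set" and x assume "x \<in> Q"
    show "\<exists>z\<in>Q. \<forall>y. (y, z) \<in> parent_rel S v f \<longrightarrow> y \<notin> Q"
    proof (cases "Q \<subseteq> S - {v}")
      case True
      then obtain u where "u \<in> Q" "f u \<in> S - Q" using W[of Q] \<open>x \<in> Q\<close> by blast
      then show ?thesis unfolding parent_rel_def by blast
    next
      case False
      then show ?thesis unfolding parent_rel_def by blast
    qed
  qed
  ultimately show ?r using P fv fn by (auto simp: PiE_def)
next
  assume r: ?r
  have "\<exists>u\<in>W. u = v \<or> f u \<in> S - W" if W: "W \<subseteq> S" "W \<noteq> {}" for W
  proof (cases "v \<in> W")
    case False
    obtain z where z: "z \<in> W" "\<forall>y. (y, z) \<in> parent_rel S v f \<longrightarrow> y \<notin> W"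
      using r W(2) unfolding wf_eq_minimal by blast
    moreover have "z \<in> S - {v}" using z W False by blast
    ultimately show ?thesis using r unfolding parent_rel_def by blast
  qed auto
  moreover have "f \<in> PiE S (parent_values G v)"
    using r unfolding parent_values_def by (auto simp: PiE_def)
  ultimately show ?l unfolding burning_def parent_ok_def by auto
qed

lemma parent_edges_connected:
  assumes wf: "wf (parent_rel S v f)" and f: "f \<in> S \<rightarrow> S" and xy: "x \<in> S" "y \<in> S"
  shows "(x, y) \<in> {(x, y). {x, y} \<in> parent_edges S v f}\<^sup>*"
proof -
  let ?R = "{(x, y). {x, y} \<in> parent_edges S v f}"
  have sym: "sym (?R\<^sup>*)" by (intro sym_rtrancl symI) (simp add: insert_commute)
  have "x \<in> S \<longrightarrow> (x, v) \<in> ?R\<^sup>*" for x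
  proof (induction x rule: wf_induct_rule[OF wf])
    case (1 x)
    show ?case
    proof (cases "x \<in> S - {v}")
      case True
      then have "(f x, x) \<in> parent_rel S v f" "f x \<in> S" "(x, f x) \<in> ?R"
        using f unfolding parent_rel_def parent_edges_def by auto
      with 1 show ?thesis by (meson converse_rtrancl_into_rtrancl)
    qed auto
  qed
  then show ?thesis using xy sym by (meson rtrancl_trans symD)
qed

text \<open>A vertex of a cycle that is not the parent of any other vertex of the cycle would have both
  its cycle neighbours as parents.\<close>

lemma parent_edges_acyclic:
  assumes wf: "wf (parent_rel S v f)" and "finite S"
  shows "\<not> ucycle \<lparr>uverts = S, uedges = parent_edges S v f\<rparr> p"
proof
  assume c: "ucycle \<lparr>uverts = S, uedges = parent_edges S v f\<rparr> p"
  let ?n = "length p"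
  have n: "3 \<le> ?n" and d: "distinct p"
    and e: "\<And>i. i < ?n \<Longrightarrow> {p ! i, p ! (Suc i mod ?n)} \<in> parent_edges S v f"
    using c unfolding ucycle_def by auto
  have "finite (parent_rel S v f)" using \<open>finite S\<close> unfolding parent_rel_def by simp
  \<comment> \<open>Finiteness makes the converse relation well-founded as well, which provides a
    vertex of the cycle with no child on the cycle.\<close>
  then have "wf ((parent_rel S v f)\<inverse>)"
    using wf by (intro finite_acyclic_wf_converse wf_acyclic)
  moreover have "p ! 0 \<in> set p" using n by (intro nth_mem) linarith
  ultimately obtain x where x: "x \<in> set p"
    and max: "\<And>y. (y, x) \<in> (parent_rel S v f)\<inverse> \<Longrightarrow> y \<notin> set p" by (rule wfE_min) blast
  have parent: "y = f x" if xy: "{x, y} \<in> parent_edges S v f" "y \<in> set p" for y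
  proof -
    obtain u where u: "u \<in> S - {v}" "{x, y} = {u, f u}"
      using xy(1) unfolding parent_edges_def by blast
    then have "u = y \<and> f y = x \<or> y = f x" by (auto simp: doubleton_eq_iff)
    then show ?thesis using max[of y] u xy(2) unfolding parent_rel_def by blast
  qed
  obtain i where i: "i < ?n" "p ! i = x" using x by (auto simp: in_set_conv_nth)
  define j where "j = (if i = 0 then ?n - 1 else i - 1)"
  have j: "j < ?n" "Suc j mod ?n = i" using i n unfolding j_def by (auto simp: Suc_diff_Suc)
  define k where "k = Suc i mod ?n"
  have k: "k < ?n" unfolding k_def by (intro mod_less_divisor) (use n in linarith)
  have "p ! k = f x" using e[OF i(1)] i k parent[of "p ! k"] unfolding k_def by simp
  moreover have "p ! j = f x"
    using e[OF j(1)] i j parent[of "p ! j"] by (simp add: insert_commute)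
  ultimately have "p ! j = p ! k" by simp
  then have "j = k" using nth_eq_iff_index_eq[OF d j(1) k] by blast
  \<comment> \<open>The cyclic predecessor and successor of an index differ when the length is at
    least 3.\<close>
  then show False using i n unfolding j_def k_def
    by (cases "Suc i = ?n") (auto split: if_splits)
qed

text \<open>Induction from the root outwards: the edge from \<open>u\<close> to \<open>f u\<close>
  is also a parent edge of \<open>g\<close>. If \<open>g\<close> directed it the other way, the
  induction hypothesis at \<open>f u\<close> would make \<open>u\<close> and \<open>f u\<close>
  parents of each other under \<open>f\<close>, contradicting well-foundedness.\<close>

lemma inj_on_parent_edges:
  assumes v: "v \<in> S"
  shows "inj_on (parent_edges S v) (burning (parent_values G v) (parent_ok G v) {} S)"
proof (rule inj_onI)
  fix f g assume fg: "f \<in> burning (parent_values G v) (parent_ok G v) {} S"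
    "g \<in> burning (parent_values G v) (parent_ok G v) {} S" "parent_edges S v f = parent_edges S v g"
  note F = fg(1)[unfolded burning_parent_iff[OF v]] and H = fg(2)[unfolded burning_parent_iff[OF v]]
  have wf: "wf (parent_rel S v f)" using F by blast
  have "u \<in> S \<longrightarrow> f u = g u" for u
  proof (induction u rule: wf_induct_rule[OF wf])
    case (1 u)
    show ?case
    proof (cases "u \<in> S - {v}")
      case True
      then have "{u, f u} \<in> parent_edges S v g" using fg(3) unfolding parent_edges_def by blast
      then obtain w where w: "w \<in> S - {v}" "{u, f u} = {w, g w}" unfolding parent_edges_def by blast
      have uu: "(f u, u) \<in> parent_rel S v f" using True unfolding parent_rel_def by blast
      consider "w = u" "f u = g u" | "w = f u" "g w = u" using w(2) by (auto simp: doubleton_eq_iff)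
      then show ?thesis
      proof cases
        case 2
        then have "f w = u" using 1[of w] uu w(1) by auto
        then have "(u, w) \<in> parent_rel S v f" using w(1) unfolding parent_rel_def by force
        then show ?thesis using uu 2(1) wf_asym[OF wf] by blast
      qed simp
    next
      case False
      then show ?thesis using F H by auto
    qed
  qed
  moreover have "f \<in> extensional S" "g \<in> extensional S" using F H by (auto simp: PiE_def)
  ultimately show "f = g" by (intro extensionalityI) auto
qed

lemma cycle_of_path:
  assumes xy: "{x, y} \<in> E" "x \<noteq> y" "{x, y} \<notin> F" and F: "F \<subseteq> E"
    and path: "(x, y) \<in> {(x, y). {x, y} \<in> F}\<^sup>*"
  shows "\<exists>p. ucycle \<lparr>uverts = S, uedges = E\<rparr> p"
proof -
  let ?r = "\<lambda>x y. {x, y} \<in> F"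
  have "?r\<^sup>*\<^sup>* x y" using path by (simp add: rtranclp_rtrancl_eq)
  then obtain xs where "rtrancl_path ?r x xs y" using rtranclp_eq_rtrancl_path by metis
  then obtain xs where xs: "rtrancl_path ?r x xs y" "distinct (x # xs)"
    by (rule rtrancl_path_distinct)
  have "xs \<noteq> []" using xs(1) xy(2) by (auto elim: rtrancl_path.cases)
  then have last: "last xs = y" using xs(1) rtrancl_path_last by metis
  have step: "{(x # xs) ! i, xs ! i} \<in> F" if "i < length xs" for i
    using rtrancl_path_nth[OF xs(1) that] .
  \<comment> \<open>The path has to be longer than a single edge, for otherwise closing it up would
    not give a cycle. A single edge would be the one that \<open>F\<close> lacks.\<close>
  have "length xs \<noteq> 1"
  proof
    assume "length xs = 1"
    then have "{x, y} \<in> F" using step[of 0] last \<open>xs \<noteq> []\<close> by (auto simp: last_conv_nth)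
    then show False using xy by simp
  qed
  then have len: "length (x # xs) \<ge> 3" using \<open>xs \<noteq> []\<close> by (cases xs) (auto simp: Suc_le_eq)
  have "{(x # xs) ! i, (x # xs) ! (Suc i mod length (x # xs))} \<in> E" if i: "i < length (x # xs)" for i
  proof (cases "i < length xs")
    case True
    then show ?thesis using step F by auto
  next
    case False
    then have "i = length xs" using i by simp
    moreover have "(x # xs) ! length xs = y"
      using last \<open>xs \<noteq> []\<close> by (metis last_ConsR last_conv_nth length_Cons diff_Suc_1 list.distinct(1))
    ultimately show ?thesis using xy(1) by (simp add: insert_commute)
  qed
  then show ?thesis using len xs(2) unfolding ucycle_def by (intro exI[of _ "x # xs"]) auto
qed

text \<open>The parent of a vertex is a neighbour in \<open>T\<close> with smaller distance
  \<open>d\<close> to \<open>v\<close>, so \<open>d\<close> is a measure for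
  \<open>parent_rel\<close>.\<close>

lemma spanning_tree_parent:
  assumes G: "fin_simple_graph G" and T: "usubgraph T G" "utree T" and v: "v \<in> uverts T"
  shows "\<exists>f\<in>burning (parent_values G v) (parent_ok G v) {} (uverts T).
    uedges T = parent_edges (uverts T) v f"
proof -
  let ?S = "uverts T" and ?R = "{(x, y). {x, y} \<in> uedges T}"
  have eT: "e \<subseteq> ?S" "e \<in> uedges G" "card e = 2" if "e \<in> uedges T" for e
    using that T(1) G unfolding usubgraph_def fin_simple_graph_def by auto
  have conn: "(u, v) \<in> ?R\<^sup>*" if "u \<in> ?S" for u
    using T(2) v that unfolding utree_def uconnected_def by blast
  define d where "d u = (LEAST n. (u, v) \<in> ?R ^^ n)" for u
  have "\<exists>w. {u, w} \<in> uedges T \<and> d w < d u" if u: "u \<in> ?S - {v}" for u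
  proof -
    obtain n where "(u, v) \<in> ?R ^^ n" using conn[of u] u rtrancl_imp_relpow by blast
    then have du: "(u, v) \<in> ?R ^^ d u" unfolding d_def by (rule LeastI)
    then obtain m where m: "d u = Suc m" using u by (cases "d u") auto
    then obtain w where w: "(u, w) \<in> ?R" "(w, v) \<in> ?R ^^ m" using du relpow_Suc_D2 by metis
    then have "d w \<le> m" unfolding d_def by (intro Least_le)
    then show ?thesis using w m by auto
  qed
  then obtain g where g: "\<And>u. u \<in> ?S - {v} \<Longrightarrow> {u, g u} \<in> uedges T \<and> d (g u) < d u" by metis
  define f where "f = restrict (g(v := v)) ?S"
  have f: "{u, f u} \<in> uedges T" "d (f u) < d u" if "u \<in> ?S - {v}" for u
    using g[OF that] that unfolding f_def by auto
  have fv: "f v = v" using v unfolding f_def by simp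
  have fS: "f u \<in> ?S" if "u \<in> ?S" for u
    using that v fv eT(1)[OF f(1)[of u]] by (cases "u = v") auto
  have "parent_rel ?S v f \<subseteq> measure d" unfolding parent_rel_def by (auto intro!: f(2))
  then have wf: "wf (parent_rel ?S v f)" by (rule wf_subset[OF wf_measure])
  have fn: "f u \<in> nbrs G u" if "u \<in> ?S - {v}" for u
    using eT(2)[OF f(1)[OF that]] unfolding nbrs_def by simp
  have sub: "parent_edges ?S v f \<subseteq> uedges T" unfolding parent_edges_def by (auto intro!: f(1))
  \<comment> \<open>The parent edges already connect all vertices, so any further edge of
    \<open>T\<close> would close a cycle.\<close>
  have "uedges T \<subseteq> parent_edges ?S v f"
  proof
    fix e assume e: "e \<in> uedges T"
    then obtain x y where xy: "e = {x, y}" "x \<noteq> y" using eT(3) by (meson card_2_iff)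
    show "e \<in> parent_edges ?S v f"
    proof (rule ccontr)
      assume "e \<notin> parent_edges ?S v f"
      moreover have "(x, y) \<in> {(x, y). {x, y} \<in> parent_edges ?S v f}\<^sup>*"
        using parent_edges_connected[OF wf] fS eT(1)[OF e] xy by auto
      ultimately have "\<exists>p. ucycle \<lparr>uverts = ?S, uedges = uedges T\<rparr> p"
        using cycle_of_path[OF _ xy(2) _ sub] e xy by blast
      then show False using T(2) unfolding utree_def ucycle_def by simp
    qed
  qed
  moreover have "f \<in> burning (parent_values G v) (parent_ok G v) {} ?S"
    unfolding burning_parent_iff[OF v] using fS fv fn wf by (auto simp: f_def)
  ultimately show ?thesis using sub by blast
qed

lemma card_spanning_trees:
  assumes G: "fin_simple_graph G" and S: "S \<subseteq> uverts G" and v: "v \<in> S"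
  shows "card {T. usubgraph T G \<and> utree T \<and> uverts T = S} =
         card (burning (parent_values G v) (parent_ok G v) {} S)"
proof -
  let ?B = "burning (parent_values G v) (parent_ok G v) {} S"
  let ?h = "\<lambda>f. \<lparr>uverts = S, uedges = parent_edges S v f\<rparr>"
  have finS: "finite S" using S G finite_subset unfolding fin_simple_graph_def by blast
  have "?h f \<in> {T. usubgraph T G \<and> utree T \<and> uverts T = S}" if f: "f \<in> ?B" for f
  proof -
    note F = f[unfolded burning_parent_iff[OF v]]
    have "usubgraph (?h f) G"
      using S F unfolding usubgraph_def parent_edges_def nbrs_def by auto
    moreover have "utree (?h f)"
      using F v parent_edges_connected[of S v f] parent_edges_acyclic[of S v f, OF _ finS]
      unfolding utree_def uconnected_def by (auto simp: PiE_def)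
    ultimately show ?thesis by simp
  qed
  moreover have "T \<in> ?h ` ?B" if T: "usubgraph T G" "utree T" "uverts T = S" for T
  proof -
    obtain f where "f \<in> ?B" "uedges T = parent_edges S v f"
      using spanning_tree_parent[OF G T(1,2), of v] v T(3) by blast
    moreover from this(2) have "T = ?h f" using T(3) by simp
    ultimately show ?thesis by blast
  qed
  ultimately have "{T. usubgraph T G \<and> utree T \<and> uverts T = S} = ?h ` ?B" by blast
  moreover have "inj_on ?h ?B" using inj_on_parent_edges[OF v, of G] by (auto simp: inj_on_def)
  ultimately show ?thesis by (simp add: card_image)
qed

section \<open>Assembling the sum\<close>

lemma card_burnt_set_configs:
  assumes G: "fin_simple_graph G" and S: "S \<subseteq> uverts G" and v: "v \<in> S"
  shows "card {C \<in> relaxed_legal G. burnt_set G (C(v := C v + 1)) S} =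
    card {T. usubgraph T G \<and> utree T \<and> uverts T = S} * num_relaxed_legal (del_uverts G S)"
proof -
  have finS: "finite S" using S G finite_subset unfolding fin_simple_graph_def by blast
  have "relaxed_legal (del_uverts G S) \<subseteq> (uverts G - S) \<rightarrow>\<^sub>E UNIV"
    unfolding relaxed_legal_def configs_def del_uverts_def by auto
  then show ?thesis
    unfolding burnt_set_configs[OF assms] card_spanning_trees[OF assms] num_relaxed_legal_def
      card_chip_eq_card_parent[OF G finS, symmetric]
    by (intro card_PiE_split) (auto simp: burning_def PiE_def)
qed

theorem theorem4p2:
  fixes G :: "'a ugraph" and l :: nat
  assumes "fin_simple_graph G" and "l > 0"
  shows "card {(C, v). (C, v) \<in> relaxed_legal G \<times> uverts G \<and> burn_off_game_length G C v l} =
    (\<Sum>v\<in>uverts G. \<Sum>T\<in>subtrees G v l. num_relaxed_legal (del_uverts G (uverts T)))"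
proof -
  note G = assms(1)
  let ?V = "uverts G"
  have finV: "finite ?V" using G unfolding fin_simple_graph_def by blast
  have finR: "finite (relaxed_legal G)" by (rule finite_relaxed_legal[OF G])
  have "card {C \<in> relaxed_legal G. burn_off_game_length G C v l} =
      (\<Sum>T\<in>subtrees G v l. num_relaxed_legal (del_uverts G (uverts T)))" if v: "v \<in> ?V" for v
  proof -
    let ?X = "\<lambda>S. {C \<in> relaxed_legal G. burnt_set G (C(v := C v + 1)) S}"
    let ?I = "{S. S \<subseteq> ?V \<and> card S = l \<and> v \<in> S}"
    let ?T = "\<lambda>S. {T. usubgraph T G \<and> utree T \<and> uverts T = S}"
    have finI: "finite ?I" using finV by simp
    have finT: "finite (?T S)" for S
    proof (rule finite_subset)
      show "?T S \<subseteq> (\<lambda>E. \<lparr>uverts = S, uedges = E\<rparr>) ` Pow (Pow ?V)"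
      proof
        fix T assume "T \<in> ?T S"
        then have "T = \<lparr>uverts = S, uedges = uedges T\<rparr>" "uedges T \<in> Pow (Pow ?V)"
          using G unfolding usubgraph_def fin_simple_graph_def by auto
        then show "T \<in> (\<lambda>E. \<lparr>uverts = S, uedges = E\<rparr>) ` Pow (Pow ?V)" by blast
      qed
    qed (use finV in simp)
    have "{C \<in> relaxed_legal G. burn_off_game_length G C v l} = (\<Union>S\<in>?I. ?X S)"
    proof (intro equalityI subsetI)
      fix C assume C: "C \<in> {C \<in> relaxed_legal G. burn_off_game_length G C v l}"
      then have R: "C \<in> relaxed_legal G" "relaxed G C" unfolding relaxed_legal_def by auto
      then obtain S where S: "burnt_set G (C(v := C v + 1)) S" "card S = l"
        using C burn_off_iff[OF G] by blast
      \<comment> \<open>Positivity of \<open>l\<close> makes \<open>S\<close> nonempty, so the fire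
        starts at the seeded vertex.\<close>
      moreover have "v \<in> S"
        using burnt_set_seed(1)[OF G relaxedD[OF R(2)] S(1)] S(2) assms(2) by fastforce
      moreover have "S \<subseteq> ?V" using S(1) unfolding burnt_set_def burnable_def by blast
      ultimately show "C \<in> (\<Union>S\<in>?I. ?X S)" using R by blast
    next
      fix C assume "C \<in> (\<Union>S\<in>?I. ?X S)"
      then show "C \<in> {C \<in> relaxed_legal G. burn_off_game_length G C v l}"
        using burn_off_iff[OF G] unfolding relaxed_legal_def by blast
    qed
    then have "card {C \<in> relaxed_legal G. burn_off_game_length G C v l} = card (\<Union>S\<in>?I. ?X S)"
      by simp
    \<comment> \<open>The classes are disjoint because a configuration has only one burnt
      set.\<close>
    also have "\<dots> = (\<Sum>S\<in>?I. card (?X S))"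
      using finI finR by (intro card_UN_disjoint) (auto dest: burnt_set_unique[OF G])
    \<comment> \<open>The number of trees on \<open>S\<close> times the number of configurations on
      the rest is a sum over these trees with constant summand, as all of them have vertex set
      \<open>S\<close>.\<close>
    also have "\<dots> = (\<Sum>S\<in>?I. \<Sum>T\<in>?T S. num_relaxed_legal (del_uverts G (uverts T)))"
      using card_burnt_set_configs[OF G] by (intro sum.cong) auto
    also have "\<dots> = (\<Sum>T\<in>(\<Union>S\<in>?I. ?T S). num_relaxed_legal (del_uverts G (uverts T)))"
      using finI finT by (intro sum.UNION_disjoint[symmetric]) auto
    also have "(\<Union>S\<in>?I. ?T S) = subtrees G v l"
      unfolding subtrees_def usubgraph_def by auto
    finally show ?thesis .
  qed
  moreover have "{(C, v). (C, v) \<in> relaxed_legal G \<times> ?V \<and> burn_off_game_length G C v l} =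
      prod.swap ` (SIGMA v:?V. {C \<in> relaxed_legal G. burn_off_game_length G C v l})"
    by force
  ultimately show ?thesis using finV finR by (simp add: card_image inj_on_def)
qed

end
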